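(* Let $\lambda$ and $\mu$ be partitions with $\mu$ contained in $\lambda$. Let $\Phi$ and $\Psi$ be the two algorithms (forward and backward evacuation) described in the context. Then $\Phi$ is a well-defined map from the set of semistandard Young tableaux of shape $\lambda/\mu$ to the set of reverse semistandard Young tableaux of shape $\lambda/\mu$, $\Psi$ is a well-defined map from the set of reverse semistandard Young tableaux of shape $\lambda/\mu$ to the set of semistandard Young tableaux of shape $\lambda/\mu$, both maps preserve the norm $n(\cdot)$, and $\Phi$ and $\Psi$ are inverse to each other. In other words, they define a norm-preserving one-to-one correspondence between semistandard Young tableaux and reverse semistandard Young tableaux of shape $\lambda/\mu$.
   Context: **Basic notions.** A partition is a sequence $\lambda=(\lambda_1,\dots,\lambda_r)$ with $\lambda_1\ge\dots\ge\lambda_r>0$. Its Ferrers diagram has $r$ left-justified rows with $\lambda_i$ cells in row $i$ (row 1 on top); the cell in row $i$ and column $j$ is $(i,j)$. A partition $\mu=(\mu_1,\dots,\mu_s)$ is contained in $\lambda$ if $s\le r$ and $\mu_i\le\lambda_i$ for $1\le i\le s$. The skew diagram $\lambda/\mu$ consists of the cells of $\lambda$ that are not cells of $\mu$. A tabloid of shape $\lambda/\mu$ is a filling $T$ of the cells of $\lambda/\mu$ with non-negative integers; $T_\rho$ is the entry in cell $\rho$, and the norm $n(T)$ is the sum of all entries of $T$. A semistandard Young tableau (SSYT) of shape $\lambda/\mu$ is a tabloid whose entries are weakly increasing along rows (left to right) and strictly increasing along columns (top to bottom). A reverse SSYT of shape $\lambda/\mu$ is a tabloid whose entries are weakly decreasing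 along rows and strictly decreasing along columns. During the algorithms some cells may be empty (contain no entry); the empty tableau of shape $\lambda/\mu$ has all cells empty. **Algorithm $\Phi$** (input: an SSYT $P$ of shape $\lambda/\mu$; output: $Q$). Let $Q$ be the empty tableau of shape $\lambda/\mu$. While some cell of $P$ contains an entry, do the following. 1. Let $e$ be the minimum of all entries of $P$. Among all cells $\tau$ with $P_\tau=e$, let $\rho=(i,j)$ be the rightmost one. 2. While the cell to the right of $\rho$ or the cell below $\rho$ contains an entry in $P$: write $\rho=(i,j)$ for the current cell, let $x$ be the entry to the right of $\rho$ (in $(i,j+1)$) and $y$ the entry below $\rho$ (in $(i+1,j)$), where one of the two may be absent (cell missing or empty). - If $x<y$, or there is no entry below $\rho$: interchange the entries $e$ (in $\rho$) and $x$, and let $\rho$ become $(i,j+1)$. - Otherwise ($x\ge y$, or there is no entry to the right): interchange the entries $e$ and $y$, and let $\rho$ become $(i+1,j)$. 3. Set $Q_\rho=e$ and delete the entry of cell $\rho$ from $P$. The output is the final $Q$. **Algorithm $\Psi$** (input: a reverse SSYT $Q$ of shape $\lambda/\mu$; output: $P$). Let $P$ be the empty tableau of shape $\lambda/\mu$. While some cell of $Q$ contains an entry, do the following. 1. Let $e$ be the maximum of all entries of $Q$. Among all cells $\tau$ with $Q_\tau=e$, let $\rho=(i,j)$ be the leftmost one. Set $P_\rho=e$ and delete the entry of cell $\rho$ from $Q$. 2. While the cell to the left of $\rho$ or the cell above $\rho$ contains an entry in $P$: write $\rho=(i,j)$ for the current cell, let $x$ be the entry of $P$ to the left of $\rho$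 (in $(i,j-1)$) and $y$ the entry of $P$ above $\rho$ (in $(i-1,j)$), where one of the two may be absent (cell missing or empty). - If $x>y$, or there is no entry above $\rho$: interchange the entries $e$ (in $\rho$) and $x$, and let $\rho$ become $(i,j-1)$. - Otherwise ($x\le y$, or there is no entry to the left): interchange the entries $e$ and $y$, and let $\rho$ become $(i-1,j)$. The output is the final $P$. *)

theory Defs
  imports Main
begin

text \<open>Rows and columns are numbered from 1, so no cell has a coordinate 0.\<close>

type_synonym cell = "nat \<times> nat"

text \<open>\<^term>\<open>None\<close> stands both for an empty cell and for a position outside the shape.\<close>

type_synonym filling = "cell \<Rightarrow> nat option"

definition is_partition :: "nat list \<Rightarrow> bool" where
  "is_partition l \<longleftrightarrow> sorted_wrt (\<ge>) l \<and> (\<forall>x \<in> set l. x > 0)"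

definition contained_in :: "nat list \<Rightarrow> nat list \<Rightarrow> bool" where
  "contained_in m l \<longleftrightarrow> length m \<le> length l \<and> (\<forall>i < length m. m ! i \<le> l ! i)"

definition diagram :: "nat list \<Rightarrow> cell set" where
  "diagram l = {(i, j). 1 \<le> i \<and> i \<le> length l \<and> 1 \<le> j \<and> j \<le> l ! (i - 1)}"

definition skew :: "nat list \<Rightarrow> nat list \<Rightarrow> cell set" where
  "skew l m = diagram l - diagram m"

definition tabloids :: "nat list \<Rightarrow> nat list \<Rightarrow> filling set" where
  "tabloids l m = {T. dom T = skew l m}"

definition norm_of :: "filling \<Rightarrow> nat" where
  "norm_of T = (\<Sum>c \<in> dom T. the (T c))"

definition SSYT :: "nat list \<Rightarrow> nat list \<Rightarrow> filling set" where
  "SSYT l m = {T \<in> tabloids l m.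
     (\<forall>i j j' a b. j < j' \<longrightarrow> T (i, j) = Some a \<longrightarrow> T (i, j') = Some b \<longrightarrow> a \<le> b) \<and>
     (\<forall>i i' j a b. i < i' \<longrightarrow> T (i, j) = Some a \<longrightarrow> T (i', j) = Some b \<longrightarrow> a < b)}"

definition reverse_SSYT :: "nat list \<Rightarrow> nat list \<Rightarrow> filling set" where
  "reverse_SSYT l m = {T \<in> tabloids l m.
     (\<forall>i j j' a b. j < j' \<longrightarrow> T (i, j) = Some a \<longrightarrow> T (i, j') = Some b \<longrightarrow> a \<ge> b) \<and>
     (\<forall>i i' j a b. i < i' \<longrightarrow> T (i, j) = Some a \<longrightarrow> T (i', j) = Some b \<longrightarrow> a > b)}"

text \<open>
  Both algorithms are partial functions into an option type. The result \<^term>\<open>None\<close> means that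
  a loop does not terminate, or that ``the rightmost'' (``the leftmost'') cell holding the selected
  entry is not uniquely determined.
\<close>

definition rightmost :: "filling \<Rightarrow> nat \<Rightarrow> cell \<Rightarrow> bool" where
  "rightmost T e c \<longleftrightarrow> T c = Some e \<and> (\<forall>d. T d = Some e \<longrightarrow> snd d \<le> snd c)"

definition leftmost :: "filling \<Rightarrow> nat \<Rightarrow> cell \<Rightarrow> bool" where
  "leftmost T e c \<longleftrightarrow> T c = Some e \<and> (\<forall>d. T d = Some e \<longrightarrow> snd c \<le> snd d)"

definition the_unique :: "('a \<Rightarrow> bool) \<Rightarrow> 'a option" where
  "the_unique R = (if \<exists>!c. R c then Some (THE c. R c) else None)"

text \<open>
  The neighbour with which the moving entry is interchanged next; \<^term>\<open>None\<close> if it stops.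
  In \<open>psi_next\<close> truncated subtraction is harmless: a neighbour of a cell in the first row or
  column then has a coordinate 0 and carries no entry.
\<close>

definition phi_next :: "filling \<Rightarrow> cell \<Rightarrow> cell option" where
  "phi_next P c = (case c of (i, j) \<Rightarrow>
     (case (P (i, j + 1), P (i + 1, j)) of
        (None, None) \<Rightarrow> None
      | (Some x, None) \<Rightarrow> Some (i, j + 1)
      | (None, Some y) \<Rightarrow> Some (i + 1, j)
      | (Some x, Some y) \<Rightarrow> if x < y then Some (i, j + 1) else Some (i + 1, j)))"

definition psi_next :: "filling \<Rightarrow> cell \<Rightarrow> cell option" where
  "psi_next P c = (case c of (i, j) \<Rightarrow>
     (case (P (i, j - 1), P (i - 1, j)) of
        (None, None) \<Rightarrow> None
      | (Some x, None) \<Rightarrow> Some (i, j - 1)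
      | (None, Some y) \<Rightarrow> Some (i - 1, j)
      | (Some x, Some y) \<Rightarrow> if x > y then Some (i, j - 1) else Some (i - 1, j)))"

partial_function (option) slide ::
  "(filling \<Rightarrow> cell \<Rightarrow> cell option) \<Rightarrow> filling \<Rightarrow> cell \<Rightarrow> (filling \<times> cell) option"
where
  "slide nxt P c = (case nxt P c of
     None \<Rightarrow> Some (P, c)
   | Some d \<Rightarrow> slide nxt (P(c := P d, d := P c)) d)"

partial_function (option) phi_loop :: "filling \<Rightarrow> filling \<Rightarrow> filling option" where
  "phi_loop P Q = (if P = Map.empty then Some Q else
     (let e = Min (ran P) in
      Option.bind (the_unique (rightmost P e)) (\<lambda>c.
      Option.bind (slide phi_next P c) (\<lambda>(P', c').
      phi_loop (P'(c' := None)) (Q(c' := Some e))))))"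

partial_function (option) psi_loop :: "filling \<Rightarrow> filling \<Rightarrow> filling option" where
  "psi_loop Q P = (if Q = Map.empty then Some P else
     (let e = Max (ran Q) in
      Option.bind (the_unique (leftmost Q e)) (\<lambda>c.
      Option.bind (slide psi_next (P(c := Some e)) c) (\<lambda>(P', c').
      psi_loop (Q(c := None)) P'))))"

definition Phi :: "filling \<Rightarrow> filling option" where
  "Phi P = phi_loop P Map.empty"

definition Psi :: "filling \<Rightarrow> filling option" where
  "Psi Q = psi_loop Q Map.empty"

end

theory Submission
  imports Defs
begin

text \<open>
  A slide keeps the tableau semistandard away from the moving entry, and the backward rule undoes
  each of its steps. Two consecutive slides from equal entries have paths that do not cross, so they
  end in strictly decreasing columns. This makes \<open>Q\<close> a reverse semistandard tableau and also shows
  that \<^term>\<open>Psi\<close> selects the cells of \<open>Q\<close> in the opposite order, so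
  \<^term>\<open>Psi\<close> is a left inverse of \<^term>\<open>Phi\<close>. It is a two-sided inverse by counting: replacing
  every entry \<open>x\<close> by \<open>N - x\<close> matches the finitely many semistandard and reverse semistandard
  tableaux with entries at most \<open>N\<close>.
\<close>

section \<open>Convex cell sets and the order on a tableau\<close>

text \<open>Captures what the slides need of a skew shape. Convexity in the product order survives
  deletion of a maximal cell, so it stays available for the shrinking domain of \<open>P\<close>.
  Positive coordinates make the truncated subtractions in \<open>psi_next\<close> genuine
  steps.\<close>

definition region :: "cell set \<Rightarrow> bool" where
  "region D \<longleftrightarrow> finite D \<and> (\<forall>(i, j) \<in> D. 0 < i \<and> 0 < j) \<and>
     (\<forall>i j i' j' p q. (i, j) \<in> D \<longrightarrow> (i', j') \<in> D \<longrightarrow> i \<le> p \<longrightarrow> p \<le> i' \<longrightarrow> j \<le> q \<longrightarrow> q \<le> j'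
        \<longrightarrow> (p, q) \<in> D)"

text \<open>Compares all pairs in northwest-southeast position at once; on a convex domain with
  \<open>H\<close> empty this is equivalent to semistandardness. \<open>H\<close> exempts the cell
  whose entry is in transit.\<close>

definition ordered_off :: "cell set \<Rightarrow> filling \<Rightarrow> bool" where
  "ordered_off H P \<longleftrightarrow> (\<forall>i j i' j' a b. i \<le> i' \<longrightarrow> j \<le> j' \<longrightarrow> (i, j) \<notin> H \<longrightarrow> (i', j') \<notin> H \<longrightarrow>
     P (i, j) = Some a \<longrightarrow> P (i', j') = Some b \<longrightarrow> a \<le> b \<and> (i < i' \<longrightarrow> a < b))"

lemma region_convex:
  assumes "region D" "(i, j) \<in> D" "(i', j') \<in> D" "i \<le> p" "p \<le> i'" "j \<le> q" "q \<le> j'"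
  shows "(p, q) \<in> D"
  using assms unfolding region_def by blast

lemma region_pos: "region D \<Longrightarrow> (i, j) \<in> D \<Longrightarrow> 0 < i \<and> 0 < j"
  unfolding region_def by blast

lemma region_finite: "region D \<Longrightarrow> finite D"
  unfolding region_def by blast

lemma ordered_offD:
  assumes "ordered_off H P" "P (i, j) = Some a" "P (i', j') = Some b"
    "i \<le> i'" "j \<le> j'" "(i, j) \<notin> H" "(i', j') \<notin> H"
  shows "a \<le> b" "i < i' \<Longrightarrow> a < b"
  using assms unfolding ordered_off_def by blast+

lemma ordered_off_remove:
  assumes "ordered_off {c} P"
  shows "ordered_off {} (P(c := None))"
  unfolding ordered_off_def
proof (intro allI impI)
  fix i j i' j' a b
  assume le: "i \<le> i'" "j \<le> j'"
    and ab: "(P(c := None)) (i, j) = Some a" "(P(c := None)) (i', j') = Some b"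
  have "(i, j) \<noteq> c" "(i', j') \<noteq> c" using ab by (simp_all split: if_splits)
  then show "a \<le> b \<and> (i < i' \<longrightarrow> a < b)"
    using ordered_offD[OF assms, of i j a i' j' b] ab le by simp
qed

text \<open>Any other cell of \<open>D\<close> to the southeast would, by convexity, force the right
  or the lower neighbour of \<open>(i, j)\<close> into \<open>D\<close>.\<close>

lemma region_maximal:
  assumes "region D" "(i, j) \<in> D" "(i, j + 1) \<notin> D" "(i + 1, j) \<notin> D"
    and "(p, q) \<in> D" "i \<le> p" "j \<le> q"
  shows "(p, q) = (i, j)"
proof (rule ccontr)
  assume "(p, q) \<noteq> (i, j)"
  then have "i + 1 \<le> p \<or> j + 1 \<le> q" using assms by auto
  then show False
    using region_convex[OF assms(1,2,5), of i "j + 1"] region_convex[OF assms(1,2,5), of "i + 1" j]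
      assms by auto
qed

text \<open>Convexity could only fail if \<open>(i, j)\<close> lay between two remaining cells, and
  then the second of them would contradict maximality.\<close>

lemma region_remove_maximal:
  assumes "region D" and max: "\<And>p q. (p, q) \<in> D \<Longrightarrow> i \<le> p \<Longrightarrow> j \<le> q \<Longrightarrow> (p, q) = (i, j)"
  shows "region (D - {(i, j)})"
  unfolding region_def
proof (intro conjI allI impI)
  show "finite (D - {(i, j)})" using region_finite[OF assms(1)] by simp
  show "\<forall>(i, j) \<in> D - {(i, j)}. 0 < i \<and> 0 < j" using region_pos[OF assms(1)] by blast
next
  fix a b a' b' p q
  assume *: "(a, b) \<in> D - {(i, j)}" "(a', b') \<in> D - {(i, j)}" "a \<le> p" "p \<le> a'" "b \<le> q" "q \<le> b'"
  then have "(p, q) \<in> D" using region_convex[OF assms(1), of a b a' b' p q] by blast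
  moreover have "(p, q) \<noteq> (i, j)" using max[of a' b'] * by auto
  ultimately show "(p, q) \<in> D - {(i, j)}" by blast
qed

section \<open>Forward slides as paths\<close>

text \<open>A terminating run of the forward slide as a derivation, so that its properties follow by
  induction along the path. The premises encode the tie rule: equal neighbours send the entry
  down.\<close>

inductive phi_path :: "filling \<Rightarrow> cell \<Rightarrow> filling \<Rightarrow> cell \<Rightarrow> bool" where
  stop: "P (i, j + 1) = None \<Longrightarrow> P (i + 1, j) = None \<Longrightarrow> phi_path P (i, j) P (i, j)"
| right: "P (i, j + 1) = Some x \<Longrightarrow> \<forall>y. P (i + 1, j) = Some y \<longrightarrow> x < y \<Longrightarrow>
    phi_path (P((i, j) := Some x, (i, j + 1) := P (i, j))) (i, j + 1) P' c' \<Longrightarrow>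
    phi_path P (i, j) P' c'"
| down: "P (i + 1, j) = Some y \<Longrightarrow> \<forall>x. P (i, j + 1) = Some x \<longrightarrow> y \<le> x \<Longrightarrow>
    phi_path (P((i, j) := Some y, (i + 1, j) := P (i, j))) (i + 1, j) P' c' \<Longrightarrow>
    phi_path P (i, j) P' c'"

lemma phi_path_slide: "phi_path P c P' c' \<Longrightarrow> slide phi_next P c = Some (P', c')"
proof (induction rule: phi_path.induct)
  case (stop P i j)
  then show ?case by (subst slide.simps) (simp add: phi_next_def)
next
  case (right P i j x P' c')
  then have "phi_next P (i, j) = Some (i, j + 1)"
    by (auto simp: phi_next_def split: option.split)
  then show ?case using right by (subst slide.simps) (simp del: fun_upd_apply)
next
  case (down P i j y P' c')
  then have "phi_next P (i, j) = Some (i + 1, j)"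
    by (fastforce simp: phi_next_def split: option.split)
  then show ?case using down by (subst slide.simps) (simp del: fun_upd_apply)
qed

text \<open>Every step raises the coordinate sum by one inside a bounded box.\<close>

lemma phi_path_exists:
  assumes "dom P \<subseteq> {..n} \<times> {..n}" "c \<in> dom P"
  shows "\<exists>P' c'. phi_path P c P' c'"
  using assms
proof (induction "2 * n - fst c - snd c" arbitrary: P c rule: less_induct)
  case less
  obtain i j where c: "c = (i, j)" by fastforce
  have b: "P (p, q) \<noteq> None \<Longrightarrow> p \<le> n \<and> q \<le> n" for p q using less.prems by blast
  consider (s) "P (i, j + 1) = None" "P (i + 1, j) = None"
    | (r) x where "P (i, j + 1) = Some x" "\<forall>y. P (i + 1, j) = Some y \<longrightarrow> x < y"
    | (d) y where "P (i + 1, j) = Some y" "\<forall>x. P (i, j + 1) = Some x \<longrightarrow> y \<le> x"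
    by (cases "P (i, j + 1)"; cases "P (i + 1, j)") (auto simp: not_less[symmetric])
  then show ?case
  proof cases
    case s
    then show ?thesis unfolding c by (blast intro: phi_path.stop)
  next
    case r
    let ?P = "P((i, j) := Some x, (i, j + 1) := P (i, j))"
    have "\<exists>P' c'. phi_path ?P (i, j + 1) P' c'"
    proof (rule less.hyps)
      \<comment> \<open>The new cell lies in the box, so \<open>i + j + 1 \<le> 2 * n\<close> and
        truncation does not spoil the strict decrease.\<close>
      show "2 * n - fst (i, j + 1) - snd (i, j + 1) < 2 * n - fst c - snd c"
        using b[of i "j + 1"] r unfolding c by auto
      show "dom ?P \<subseteq> {..n} \<times> {..n}" "(i, j + 1) \<in> dom ?P"
        using less.prems r unfolding c by auto
    qed
    then show ?thesis unfolding c using r by (blast intro: phi_path.right)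
  next
    case d
    let ?P = "P((i, j) := Some y, (i + 1, j) := P (i, j))"
    have "\<exists>P' c'. phi_path ?P (i + 1, j) P' c'"
    proof (rule less.hyps)
      show "2 * n - fst (i + 1, j) - snd (i + 1, j) < 2 * n - fst c - snd c"
        using b[of "i + 1" j] d unfolding c by auto
      show "dom ?P \<subseteq> {..n} \<times> {..n}" "(i + 1, j) \<in> dom ?P"
        using less.prems d unfolding c by auto
    qed
    then show ?thesis unfolding c using d by (blast intro: phi_path.down)
  qed
qed

lemma finite_cells_bounded: "finite (D :: cell set) \<Longrightarrow> \<exists>n. D \<subseteq> {..n} \<times> {..n}"
proof -
  assume f: "finite D"
  let ?n = "Max (fst ` D \<union> snd ` D)"
  have "D \<subseteq> {..?n} \<times> {..?n}" using f by (force intro!: Max_ge)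
  then show ?thesis by blast
qed

text \<open>The tableau with the moving entry at \<open>c\<close>, which alone may violate the order.\<close>

definition punctured :: "filling \<Rightarrow> cell \<Rightarrow> bool" where
  "punctured P c \<longleftrightarrow> region (dom P) \<and> c \<in> dom P \<and> ordered_off {c} P"

text \<open>Moving \<open>x\<close> one cell to the left endangers only its order with the cells
  below it in its new column; all other comparisons are inherited from its old place.\<close>

lemma punctured_right:
  assumes "punctured P (i, j)" and x: "P (i, j + 1) = Some x"
    and lt: "\<forall>y. P (i + 1, j) = Some y \<longrightarrow> x < y"
  shows "punctured (P((i, j) := Some x, (i, j + 1) := P (i, j))) (i, j + 1)"
    and "dom (P((i, j) := Some x, (i, j + 1) := P (i, j))) = dom P"
proof -
  let ?P = "P((i, j) := Some x, (i, j + 1) := P (i, j))"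
  have reg: "region (dom P)" and c: "(i, j) \<in> dom P" and ord: "ordered_off {(i, j)} P"
    using assms unfolding punctured_def by auto
  show d: "dom ?P = dom P" using c x by auto
  have "ordered_off {(i, j + 1)} ?P"
    unfolding ordered_off_def
  proof (intro allI impI)
    fix p q p' q' a b
    assume le: "p \<le> p'" "q \<le> q'" and ne: "(p, q) \<notin> {(i, j + 1)}" "(p', q') \<notin> {(i, j + 1)}"
      and a: "?P (p, q) = Some a" and b: "?P (p', q') = Some b"
    consider "(p, q) \<noteq> (i, j)" "(p', q') \<noteq> (i, j)" | "(p, q) = (i, j)" "(p', q') = (i, j)"
      | "(p, q) \<noteq> (i, j)" "(p', q') = (i, j)" | "(p, q) = (i, j)" "(p', q') \<noteq> (i, j)" by blast
    then show "a \<le> b \<and> (p < p' \<longrightarrow> a < b)"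
    proof cases
      case 1
      then have "P (p, q) = Some a" "P (p', q') = Some b" using a b ne by (auto split: if_splits)
      then show ?thesis using ordered_offD[OF ord, of p q a p' q' b] 1 le by auto
    next
      case 2
      then show ?thesis using a b by auto
    next
      case 3
      then have "P (p, q) = Some a" "b = x" using a b ne by (auto split: if_splits)
      then show ?thesis using ordered_offD[OF ord, of p q a i "j + 1" x] 3 le x by auto
    next
      case 4
      then have p': "P (p', q') = Some b" and "a = x" using a b ne by (auto split: if_splits)
      show ?thesis
      proof (cases "q' = j")
        \<comment> \<open>Convexity yields an entry \<open>y\<close> at \<open>(i + 1, j)\<close>,
          and \<open>x < y\<close> carries over to everything further down the column.\<close>
        case True
        then have "(i + 1, j) \<in> dom P"
          using region_convex[OF reg c, of p' q' "i + 1" j] p' 4 le by auto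
        then obtain y where "P (i + 1, j) = Some y" by auto
        then show ?thesis
          using ordered_offD[OF ord, of "i + 1" j y p' q' b] 4 le p' lt True \<open>a = x\<close> by force
      next
        case False
        then show ?thesis using ordered_offD[OF ord, of i "j + 1" x p' q' b] 4 le p' x \<open>a = x\<close> by auto
      qed
    qed
  qed
  then show "punctured ?P (i, j + 1)" unfolding punctured_def d using reg x by auto
qed

text \<open>Moving \<open>y\<close> up endangers only its order with cells in columns further right,
  and there the rule \<open>y \<le> x\<close> takes over.\<close>

lemma punctured_down:
  assumes "punctured P (i, j)" and y: "P (i + 1, j) = Some y"
    and lt: "\<forall>x. P (i, j + 1) = Some x \<longrightarrow> y \<le> x"
  shows "punctured (P((i, j) := Some y, (i + 1, j) := P (i, j))) (i + 1, j)"
    and "dom (P((i, j) := Some y, (i + 1, j) := P (i, j))) = dom P"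
proof -
  let ?P = "P((i, j) := Some y, (i + 1, j) := P (i, j))"
  have reg: "region (dom P)" and c: "(i, j) \<in> dom P" and ord: "ordered_off {(i, j)} P"
    using assms unfolding punctured_def by auto
  show d: "dom ?P = dom P" using c y by auto
  have "ordered_off {(i + 1, j)} ?P"
    unfolding ordered_off_def
  proof (intro allI impI)
    fix p q p' q' a b
    assume le: "p \<le> p'" "q \<le> q'" and ne: "(p, q) \<notin> {(i + 1, j)}" "(p', q') \<notin> {(i + 1, j)}"
      and a: "?P (p, q) = Some a" and b: "?P (p', q') = Some b"
    consider "(p, q) \<noteq> (i, j)" "(p', q') \<noteq> (i, j)" | "(p, q) = (i, j)" "(p', q') = (i, j)"
      | "(p, q) \<noteq> (i, j)" "(p', q') = (i, j)" | "(p, q) = (i, j)" "(p', q') \<noteq> (i, j)" by blast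
    then show "a \<le> b \<and> (p < p' \<longrightarrow> a < b)"
    proof cases
      case 1
      then have "P (p, q) = Some a" "P (p', q') = Some b" using a b ne by (auto split: if_splits)
      then show ?thesis using ordered_offD[OF ord, of p q a p' q' b] 1 le by auto
    next
      case 2
      then show ?thesis using a b by auto
    next
      case 3
      then have "P (p, q) = Some a" "b = y" using a b ne by (auto split: if_splits)
      then show ?thesis using ordered_offD[OF ord, of p q a "i + 1" j y] 3 le y by auto
    next
      case 4
      then have p': "P (p', q') = Some b" and "a = y" using a b ne by (auto split: if_splits)
      show ?thesis
      proof (cases "q' = j")
        case True
        then show ?thesis using ordered_offD[OF ord, of "i + 1" j y p' q' b] 4 le p' y \<open>a = y\<close> ne
          by auto
      next
        case False
        \<comment> \<open>The comparison runs along row \<open>i\<close>, with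
          \<open>y \<le> x \<le> v\<close>, and then down column \<open>q'\<close> to
          \<open>b\<close>; the column part supplies strictness.\<close>
        then have "(i, q') \<in> dom P" "(i, j + 1) \<in> dom P"
          using region_convex[OF reg c, of p' q' i q'] region_convex[OF reg c, of p' q' i "j + 1"]
            p' 4 le by auto
        then obtain v x where v: "P (i, q') = Some v" and x: "P (i, j + 1) = Some x" by auto
        have "y \<le> x" using lt x by auto
        also have "x \<le> v" using ordered_offD[OF ord x v] le False 4 by auto
        finally show ?thesis using ordered_offD[OF ord v p'] le False 4 \<open>a = y\<close> by auto
      qed
    qed
  qed
  then show "punctured ?P (i + 1, j)" unfolding punctured_def d using reg y by auto
qed

lemma phi_path_punctured:
  assumes "phi_path P c P' c'" "punctured P c"
  shows "punctured P' c' \<and> dom P' = dom P \<and> P' c' = P c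
    \<and> P' (fst c', snd c' + 1) = None \<and> P' (fst c' + 1, snd c') = None"
  using assms
proof (induction rule: phi_path.induct)
  case (right P i j x P' c')
  then show ?case using punctured_right[OF right.prems right.hyps(1,2)]
    by (simp del: fun_upd_apply) simp
next
  case (down P i j y P' c')
  then show ?case using punctured_down[OF down.prems down.hyps(1,2)]
    by (simp del: fun_upd_apply) simp
qed simp

lemma phi_path_mono: "phi_path P c P' c' \<Longrightarrow> fst c \<le> fst c' \<and> snd c \<le> snd c'"
  by (induction rule: phi_path.induct) auto

lemma phi_path_unchanged:
  "phi_path P c P' c' \<Longrightarrow> \<not> (fst c \<le> fst d \<and> snd c \<le> snd d) \<Longrightarrow> P' d = P d"
  by (induction rule: phi_path.induct) (auto split: if_splits)

lemma phi_path_ran: "phi_path P c P' c' \<Longrightarrow> ran P' \<subseteq> ran P"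
proof (induction rule: phi_path.induct)
  case (right P i j x P' c')
  have "ran (P((i, j) := Some x, (i, j + 1) := P (i, j))) \<subseteq> ran P"
    using right.hyps(1) by (auto simp: ran_def)
  then show ?case using right.IH by blast
next
  case (down P i j y P' c')
  have "ran (P((i, j) := Some y, (i + 1, j) := P (i, j))) \<subseteq> ran P"
    using down.hyps(1) by (auto simp: ran_def)
  then show ?case using down.IH by blast
qed simp

section \<open>Invariance of the norm under a slide\<close>

lemma norm_of_upd:
  assumes "finite (dom T)"
  shows "norm_of (T(c := Some v)) = norm_of (T(c := None)) + v"
proof -
  have "norm_of (T(c := Some v)) = v + (\<Sum>d \<in> dom T - {c}. the ((T(c := Some v)) d))"
    using assms unfolding norm_of_def by (simp add: sum.insert_remove)
  also have "(\<Sum>d \<in> dom T - {c}. the ((T(c := Some v)) d)) = norm_of (T(c := None))"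
    unfolding norm_of_def by (rule sum.cong) auto
  finally show ?thesis by (simp only: add.commute)
qed

lemma norm_of_swap:
  assumes "finite (dom P)" "P c = Some a" "P d = Some b" "c \<noteq> d"
  shows "norm_of (P(c := Some b, d := Some a)) = norm_of P"
proof -
  \<comment> \<open>Both tableaux arise from this one by putting \<open>a\<close> and
    \<open>b\<close> back, in either order.\<close>
  let ?P = "P(c := None, d := None)"
  have f: "finite (dom ?P)" using assms(1) by simp
  have fv: "finite (dom (?P(c := Some v)))" for v using f by simp
  have n: "norm_of (?P(c := Some v, d := Some w)) = norm_of ?P + v + w" for v w
  proof -
    have "norm_of (?P(c := Some v, d := Some w)) = norm_of (?P(c := Some v, d := None)) + w"
      by (rule norm_of_upd[OF fv])
    also have "?P(c := Some v, d := None) = ?P(c := Some v)" using assms(4) by auto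
    also have "norm_of (?P(c := Some v)) = norm_of (?P(c := None)) + v" by (rule norm_of_upd[OF f])
    also have "?P(c := None) = ?P" by auto
    finally show ?thesis .
  qed
  have "P = ?P(c := Some a, d := Some b)" using assms by (auto simp: fun_eq_iff)
  moreover have "P(c := Some b, d := Some a) = ?P(c := Some b, d := Some a)"
    using assms by (auto simp: fun_eq_iff)
  ultimately show ?thesis using n[of a b] n[of b a] by simp
qed

lemma phi_path_norm:
  assumes "phi_path P c P' c'" "punctured P c"
  shows "norm_of P' = norm_of P"
  using assms
proof (induction rule: phi_path.induct)
  case (right P i j x P' c')
  obtain e where e: "P (i, j) = Some e" and f: "finite (dom P)"
    using right.prems region_finite unfolding punctured_def by blast
  show ?case
    using right.IH[OF punctured_right(1)[OF right.prems right.hyps(1,2)]]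
      norm_of_swap[OF f e right.hyps(1)] e by (simp del: fun_upd_apply)
next
  case (down P i j y P' c')
  obtain e where e: "P (i, j) = Some e" and f: "finite (dom P)"
    using down.prems region_finite unfolding punctured_def by blast
  show ?case
    using down.IH[OF punctured_down(1)[OF down.prems down.hyps(1,2)]]
      norm_of_swap[OF f e down.hyps(1)] e by (simp del: fun_upd_apply)
qed simp

section \<open>Reversing a slide\<close>

text \<open>The order of the punctured tableau makes the backward rule choose the cell just left, at
  every step. Two slides are equated because the backward slide need not stop at
  \<open>c\<close>.\<close>

lemma phi_path_retrace:
  assumes "phi_path P c P' c'" "punctured P c"
  shows "slide psi_next P' c' = slide psi_next P c"
  using assms
proof (induction rule: phi_path.induct)
  case (right P i j x P' c')
  let ?P = "P((i, j) := Some x, (i, j + 1) := P (i, j))"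
  have reg: "region (dom P)" and c: "(i, j) \<in> dom P" and ord: "ordered_off {(i, j)} P"
    using right.prems unfolding punctured_def by auto
  have i: "0 < i" using region_pos[OF reg c] by simp
  \<comment> \<open>After a step to the right, \<open>x\<close> is the left neighbour and
    \<open>u\<close> the upper one; strict columns make the backward rule go left.\<close>
  have "u < x" if "P (i - 1, j + 1) = Some u" for u
    using ordered_offD(2)[OF ord that right.hyps(1)] i by auto
  then have "psi_next ?P (i, j + 1) = Some (i, j)"
    using i by (auto simp: psi_next_def split: option.split)
  then have "slide psi_next ?P (i, j + 1)
      = slide psi_next (?P((i, j + 1) := ?P (i, j), (i, j) := ?P (i, j + 1))) (i, j)"
    by (subst slide.simps) simp
  also have "?P((i, j + 1) := ?P (i, j), (i, j) := ?P (i, j + 1)) = P"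
    using right.hyps(1) by (auto simp: fun_eq_iff)
  finally show ?case
    using right.IH[OF punctured_right(1)[OF right.prems right.hyps(1,2)]] by (simp del: fun_upd_apply)
next
  case (down P i j y P' c')
  let ?P = "P((i, j) := Some y, (i + 1, j) := P (i, j))"
  have reg: "region (dom P)" and c: "(i, j) \<in> dom P" and ord: "ordered_off {(i, j)} P"
    using down.prems unfolding punctured_def by auto
  have j: "0 < j" using region_pos[OF reg c] by simp
  \<comment> \<open>After a step down, \<open>y\<close> is the upper neighbour and \<open>w\<close>
    the left one; weak rows suffice, since the backward rule resolves ties upwards.\<close>
  have "w \<le> y" if "P (i + 1, j - 1) = Some w" for w
    using ordered_offD(1)[OF ord that down.hyps(1)] j by auto
  then have "psi_next ?P (i + 1, j) = Some (i, j)"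
    using j by (fastforce simp: psi_next_def split: option.split)
  then have "slide psi_next ?P (i + 1, j)
      = slide psi_next (?P((i + 1, j) := ?P (i, j), (i, j) := ?P (i + 1, j))) (i, j)"
    by (subst slide.simps) simp
  also have "?P((i + 1, j) := ?P (i, j), (i, j) := ?P (i + 1, j)) = P"
    using down.hyps(1) by (auto simp: fun_eq_iff)
  finally show ?case
    using down.IH[OF punctured_down(1)[OF down.prems down.hyps(1,2)]] by (simp del: fun_upd_apply)
qed simp

text \<open>From a minimal entry the backward slide only passes through equal entries, so it does not
  change the tableau.\<close>

lemma psi_slide_min:
  assumes "region (dom P)" "ordered_off {} P" "P (i, j) = Some e" "\<forall>v \<in> ran P. e \<le> v"
  shows "\<exists>c. slide psi_next P (i, j) = Some (P, c)"
  using assms(3)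
proof (induction j)
  case 0
  then show ?case using region_pos[OF assms(1), of i 0] by auto
next
  case (Suc j)
  have i: "0 < i" using region_pos[OF assms(1), of i "Suc j"] Suc.prems by blast
  \<comment> \<open>An entry above would be smaller than the minimum \<open>e\<close>, so the slide
    can only go left.\<close>
  have up: "P (i - 1, Suc j) = None"
  proof (rule ccontr)
    assume "P (i - 1, Suc j) \<noteq> None"
    then obtain v where v: "P (i - 1, Suc j) = Some v" by blast
    then have "e \<le> v" using assms(4) by (auto intro: ranI)
    then show False using ordered_offD(2)[OF assms(2) v Suc.prems] i by auto
  qed
  show ?case
  proof (cases "P (i, j)")
    case None
    then show ?thesis using up by (subst slide.simps) (simp add: psi_next_def)
  next
    case (Some v)
    then have "v = e"
      using ordered_offD(1)[OF assms(2) Some Suc.prems] assms(4) by (auto simp: le_antisym ranI)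
    moreover have "P((i, Suc j) := P (i, j), (i, j) := P (i, Suc j)) = P"
      using Some Suc.prems \<open>v = e\<close> by (auto simp: fun_eq_iff)
    moreover have "psi_next P (i, Suc j) = Some (i, j)" using up Some by (simp add: psi_next_def)
    ultimately have "slide psi_next P (i, Suc j) = slide psi_next P (i, j)"
      by (subst slide.simps) simp
    then show ?thesis using Suc.IH Some \<open>v = e\<close> by simp
  qed
qed

section \<open>Traps for later slides\<close>

text \<open>A set of cells that a forward slide in \<open>P\<close> cannot leave, expressed through
  single steps in the unmodified \<open>P\<close>.\<close>

definition stable :: "filling \<Rightarrow> cell set \<Rightarrow> bool" where
  "stable P S \<longleftrightarrow> (\<forall>c \<in> S. c \<in> dom P \<longrightarrow> (\<forall>d. phi_next P c = Some d \<longrightarrow> d \<in> S))"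

lemma phi_next_SomeD:
  assumes "phi_next P (i, j) = Some d"
  shows "d = (i, j + 1) \<and> P (i, j + 1) \<noteq> None \<or> d = (i + 1, j) \<and> P (i + 1, j) \<noteq> None"
  using assms unfolding phi_next_def by (auto split: option.splits if_splits)

text \<open>The slide alters its tableau on the way, but \<open>phi_next\<close> inspects only cells
  southeast of the current one, and there the running tableau \<open>P\<close> still agrees with the
  original \<open>R\<close>.\<close>

lemma stable_phi_path:
  assumes "phi_path P c P' c'" "stable R S" "c \<in> S" "c \<in> dom R"
    and "\<And>p q. fst c \<le> p \<Longrightarrow> snd c \<le> q \<Longrightarrow> (p, q) \<noteq> c \<Longrightarrow> P (p, q) = R (p, q)"
  shows "c' \<in> S"
  using assms
proof (induction rule: phi_path.induct)
  case (right P i j x P' c')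
  have eq: "R (i, j + 1) = Some x" "R (i + 1, j) = P (i + 1, j)"
    using right.prems(4)[of i "j + 1"] right.prems(4)[of "i + 1" j] right.hyps(1) by auto
  then have "phi_next R (i, j) = Some (i, j + 1)"
    using right.hyps(2) by (auto simp: phi_next_def split: option.split)
  then have "(i, j + 1) \<in> S" using right.prems unfolding stable_def by blast
  then show ?case
    by (rule right.IH[OF right.prems(1)]) (use eq right.prems(4) in auto)
next
  case (down P i j y P' c')
  have eq: "R (i + 1, j) = Some y" "R (i, j + 1) = P (i, j + 1)"
    using down.prems(4)[of i "j + 1"] down.prems(4)[of "i + 1" j] down.hyps(1) by auto
  then have "phi_next R (i, j) = Some (i + 1, j)"
    using down.hyps(2) by (fastforce simp: phi_next_def split: option.split)
  then have "(i + 1, j) \<in> S" using down.prems unfolding stable_def by blast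
  then show ?case
    by (rule down.IH[OF down.prems(1)]) (use eq down.prems(4) in auto)
qed simp

text \<open>\<open>S\<close> consists of the cells strictly to the left of the path. A later slide that starts in \<open>S\<close>
  cannot cross the path: just before a cell where the path turned down it is forced down, too.\<close>

lemma phi_path_barrier:
  assumes "phi_path P c P' c'" "punctured P c"
  shows "\<exists>S. {(p, q). fst c \<le> p \<and> q < snd c} \<subseteq> S \<and> (\<forall>d \<in> S. snd d < snd c')
    \<and> stable (P'(c' := None)) S"
  using assms
proof (induction rule: phi_path.induct)
  case (stop P i j)
  let ?S = "{(p, q). i \<le> p \<and> q < j}"
  have reg: "region (dom P)" and c: "(i, j) \<in> dom P" using stop.prems unfolding punctured_def by auto
  have "stable (P((i, j) := None)) ?S"
    unfolding stable_def
  proof (intro ballI allI impI)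
    fix c d
    assume "c \<in> ?S" and n: "phi_next (P((i, j) := None)) c = Some d"
    then obtain p q where pq: "c = (p, q)" "i \<le> p" "q < j" by auto
    \<comment> \<open>Leaving \<open>?S\<close> would mean entering column \<open>j\<close> in row
      \<open>i\<close> or lower, where all cells are empty after the deletion.\<close>
    have "(p, j) \<notin> dom (P((i, j) := None))"
      using region_maximal[OF reg c, of p j] stop.hyps pq by auto
    then show "d \<in> ?S"
      using phi_next_SomeD[OF n[unfolded pq(1)]] pq by (cases "q + 1 = j") (auto simp: dom_def)
  qed
  then show ?case by (intro exI[of _ ?S]) (simp del: fun_upd_apply)
next
  case (right P i j x P' c')
  then obtain S where "{(p, q). i \<le> p \<and> q < j + 1} \<subseteq> S" "\<forall>d \<in> S. snd d < snd c'"
    "stable (P'(c' := None)) S"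
    using right.IH[OF punctured_right(1)[OF right.prems right.hyps(1,2)]]
    by (auto simp del: fun_upd_apply)
  then show ?case by (intro exI[of _ S]) (auto simp del: fun_upd_apply)
next
  case (down P i j y P' c')
  let ?P = "P((i, j) := Some y, (i + 1, j) := P (i, j))"
  let ?R = "P'(c' := None)"
  have reg: "region (dom P)" and c: "(i, j) \<in> dom P" and ord: "ordered_off {(i, j)} P"
    using down.prems unfolding punctured_def by auto
  obtain S where S: "{(p, q). i + 1 \<le> p \<and> q < j} \<subseteq> S" "\<forall>d \<in> S. snd d < snd c'" "stable ?R S"
    using down.IH[OF punctured_down(1)[OF down.prems down.hyps(1,2)]]
    by (auto simp del: fun_upd_apply)
  have mono: "i + 1 \<le> fst c'" "j \<le> snd c'" using phi_path_mono[OF down.hyps(3)] by auto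
  \<comment> \<open>The rest of the path starts at \<open>(i + 1, j)\<close> and moves southeast, so
    it touches neither the rows up to \<open>i\<close> nor the columns before
    \<open>j\<close>.\<close>
  have unch: "?R d = ?P d" if "fst d \<le> i \<or> snd d < j" for d
    using phi_path_unchanged[OF down.hyps(3), of d] that mono by auto
  \<comment> \<open>The trap of the remaining path is extended by the part of row \<open>i\<close>
    to the left of the path.\<close>
  let ?S = "S \<union> {i} \<times> {..<j}"
  have "stable ?R ?S"
    unfolding stable_def
  proof (intro ballI allI impI)
    fix c d
    assume "c \<in> ?S" and cd: "c \<in> dom ?R" and n: "phi_next ?R c = Some d"
    show "d \<in> ?S"
    proof (cases "c \<in> S")
      case True
      then show ?thesis using S(3) cd n unfolding stable_def by blast
    next
      case False
      then obtain q where q: "c = (i, q)" "q < j" using \<open>c \<in> ?S\<close> by auto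
      then have "(i + 1, q) \<in> S" using S(1) by auto
      \<comment> \<open>The only possible escape is from \<open>(i, j - 1)\<close> into
        \<open>(i, j)\<close>, which now holds \<open>y\<close>. Convexity provides an entry
        \<open>w \<le> y\<close> below \<open>(i, j - 1)\<close>, and the tie rule then prescribes a
        step down.\<close>
      moreover have "d \<noteq> (i, j)"
      proof
        assume d: "d = (i, j)"
        then have qj: "j = q + 1" using phi_next_SomeD[OF n[unfolded q(1)]] by auto
        have "(i, q) \<in> dom P" using cd unch[of c] q by (auto simp: domIff)
        then have "(i + 1, q) \<in> dom P"
          using region_convex[OF reg, of i q "i + 1" j "i + 1" q] down.hyps(1) qj by auto
        then obtain w where w: "P (i + 1, q) = Some w" by blast
        have "w \<le> y" using ordered_offD(1)[OF ord w down.hyps(1)] qj by auto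
        moreover have "?R (i + 1, q) = Some w" "?R (i, q + 1) = Some y"
          using unch[of "(i + 1, q)"] unch[of "(i, j)"] w qj by auto
        ultimately have "phi_next ?R (i, q) = Some (i + 1, q)"
          by (auto simp: phi_next_def)
        then show False using n q d by simp
      qed
      ultimately show ?thesis using phi_next_SomeD[OF n[unfolded q(1)]] q(2) by auto
    qed
  qed
  moreover have "{(p, q). i \<le> p \<and> q < j} \<subseteq> ?S"
  proof clarsimp
    fix p q assume "(p, q) \<notin> S" "i \<le> p" "q < j"
    then show "p = i" using S(1) subsetD[OF S(1), of "(p, q)"] by (cases "p = i") auto
  qed
  ultimately show ?case using S(2) mono by (intro exI[of _ ?S]) (auto simp del: fun_upd_apply)
qed

text \<open>The path stays in columns from \<open>n\<close> on, so the moving \<open>e\<close> never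
  meets another \<open>e\<close>. With \<open>n\<close> and \<open>k\<close> the coordinates of the
  start, this places the remaining copies of \<open>e\<close> inside the set from
  \<open>phi_path_barrier\<close>.\<close>

lemma phi_path_min_cells:
  assumes "phi_path P c P' c'" "P c = Some e" "n \<le> snd c"
    and "\<And>d. P d = Some e \<Longrightarrow> d = c \<or> snd d < n \<and> k \<le> fst d"
  shows "P' d = Some e \<Longrightarrow> d = c' \<or> snd d < n \<and> k \<le> fst d"
  using assms
proof (induction rule: phi_path.induct)
  case (right P i j x P' c')
  show ?case
  proof (rule right.IH)
    show "d = (i, j + 1) \<or> snd d < n \<and> k \<le> fst d"
      if "(P((i, j) := Some x, (i, j + 1) := P (i, j))) d = Some e" for d
      using right.prems(4)[of d] right.prems(4)[of "(i, j + 1)"] right.prems(3) right.hyps(1) that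
      by (auto split: if_splits)
  qed (use right.prems in auto)
next
  case (down P i j y P' c')
  show ?case
  proof (rule down.IH)
    show "d = (i + 1, j) \<or> snd d < n \<and> k \<le> fst d"
      if "(P((i, j) := Some y, (i + 1, j) := P (i, j))) d = Some e" for d
      using down.prems(4)[of d] down.prems(4)[of "(i + 1, j)"] down.prems(3) down.hyps(1) that
      by (auto split: if_splits)
  qed (use down.prems in auto)
qed auto


section \<open>The loop invariant and one round of the algorithm\<close>

text \<open>The conditions of \<open>reverse_SSYT\<close> without the shape, because
  \<open>Q\<close> is only partly filled during the loop.\<close>

definition reverse_semistandard :: "filling \<Rightarrow> bool" where
  "reverse_semistandard Q \<longleftrightarrow>
     (\<forall>i j j' a b. j < j' \<longrightarrow> Q (i, j) = Some a \<longrightarrow> Q (i, j') = Some b \<longrightarrow> a \<ge> b) \<and>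
     (\<forall>i i' j a b. i < i' \<longrightarrow> Q (i, j) = Some a \<longrightarrow> Q (i', j) = Some b \<longrightarrow> a > b)"

text \<open>The last condition says that the next slide from an entry \<open>e\<close> that \<open>Q\<close> already contains ends
  strictly to the left of all these entries of \<open>Q\<close>, so that the columns of \<open>Q\<close> stay strict.\<close>

definition loop_inv :: "filling \<Rightarrow> filling \<Rightarrow> bool" where
  "loop_inv P Q \<longleftrightarrow> region (dom P) \<and> ordered_off {} P \<and> finite (dom Q) \<and> reverse_semistandard Q \<and>
     (\<forall>c d. c \<in> dom P \<longrightarrow> d \<in> dom Q \<longrightarrow> \<not> (fst d \<le> fst c \<and> snd d \<le> snd c)) \<and>
     (\<forall>p \<in> ran P. \<forall>q \<in> ran Q. q \<le> p) \<and>
     (\<forall>e \<in> ran P \<inter> ran Q. \<exists>S. stable P S \<and> (\<forall>c. P c = Some e \<longrightarrow> c \<in> S) \<and>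
       (\<forall>c d. c \<in> S \<longrightarrow> Q d = Some e \<longrightarrow> snd c < snd d))"

lemma the_unique_eq:
  assumes "R c" and "\<And>d. R d \<Longrightarrow> d = c"
  shows "the_unique R = Some c"
proof -
  have "\<exists>!d. R d" using assms by blast
  moreover have "(THE d. R d) = c" using assms by (rule the_equality)
  ultimately show ?thesis unfolding the_unique_def by simp
qed

text \<open>Strict columns allow at most one \<open>e\<close> per column, which makes the rightmost
  one unique. A copy of \<open>e\<close> further left cannot lie in a higher row, since the order
  would then make it smaller than \<open>e\<close>.\<close>

lemma rightmost_min:
  assumes "region (dom P)" "ordered_off {} P" "P \<noteq> Map.empty" "e = Min (ran P)"
  obtains c where "the_unique (rightmost P e) = Some c" "P c = Some e" "\<forall>v \<in> ran P. e \<le> v"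
    "\<And>d. P d = Some e \<Longrightarrow> d = c \<or> snd d < snd c \<and> fst c \<le> fst d"
proof -
  have f: "finite (dom P)" using assms(1) region_finite by blast
  then have fr: "finite (ran P)" by (rule finite_ran)
  obtain d where "P d \<noteq> None" using assms(3) by (meson ext)
  then have "ran P \<noteq> {}" unfolding ran_def by blast
  then have eP: "e \<in> ran P" unfolding assms(4) by (rule Min_in[OF fr])
  have min: "\<forall>v \<in> ran P. e \<le> v" unfolding assms(4) using Min_le[OF fr] by blast
  let ?E = "{d. P d = Some e}"
  have "finite ?E" using f by (rule finite_subset[rotated]) blast
  then have fin: "finite (snd ` ?E)" by (rule finite_imageI)
  have "?E \<noteq> {}" using eP unfolding ran_def by blast
  then have "Max (snd ` ?E) \<in> snd ` ?E" by (intro Max_in fin) blast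
  then obtain c where "c \<in> ?E" and c_max: "Max (snd ` ?E) = snd c" by (rule imageE)
  then have c: "P c = Some e" by blast
  have max: "snd d \<le> snd c" if "P d = Some e" for d
    unfolding c_max[symmetric] by (rule Max_ge[OF fin]) (use that in blast)
  have col_le: "fst d' \<le> fst d" if "P d = Some e" "P d' = Some e" "snd d = snd d'" for d d'
    using ordered_offD(2)[OF assms(2), of "fst d" "snd d" e "fst d'" "snd d'" e] that
    unfolding prod.collapse by (intro leI notI) simp
  have col: "d = d'" if "P d = Some e" "P d' = Some e" "snd d = snd d'" for d d'
    using col_le[OF that] col_le[OF that(2,1) that(3)[symmetric]] that(3) by (simp add: prod_eq_iff)
  show ?thesis
  proof (rule that[OF _ c min])
    show "the_unique (rightmost P e) = Some c"
    proof (rule the_unique_eq)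
      show "rightmost P e c" using c max unfolding rightmost_def by blast
      fix d assume "rightmost P e d"
      then have d: "P d = Some e" "snd c \<le> snd d" using c unfolding rightmost_def by blast+
      then show "d = c" using max[of d] by (intro col c) auto
    qed
  next
    fix d assume d: "P d = Some e"
    have "\<not> fst d < fst c"
      using ordered_offD(2)[OF assms(2), of "fst d" "snd d" e "fst c" "snd c" e] c d max[OF d]
      unfolding prod.collapse by auto
    then show "d = c \<or> snd d < snd c \<and> fst c \<le> fst d"
      using max[OF d] col[OF d c] by linarith
  qed
qed

text \<open>One round of \<open>Phi\<close> preserves the invariant, and the last three facts say
  that one round of \<open>Psi\<close> undoes it.\<close>

lemma phi_step:
  assumes inv: "loop_inv P Q" and ne: "P \<noteq> Map.empty" and e: "e = Min (ran P)"
  obtains c P' c' c0 where "the_unique (rightmost P e) = Some c"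
    "slide phi_next P c = Some (P', c')" "loop_inv (P'(c' := None)) (Q(c' := Some e))"
    "P' c' = Some e" "dom P' = dom P" "c' \<in> dom P" "Q c' = None" "norm_of P' = norm_of P"
    "ran P' \<subseteq> ran P" "Max (ran (Q(c' := Some e))) = e"
    "the_unique (leftmost (Q(c' := Some e)) e) = Some c'" "slide psi_next P' c' = Some (P, c0)"
proof -
  have reg: "region (dom P)" and ord: "ordered_off {} P" and fQ: "finite (dom Q)"
    and rev: "reverse_semistandard Q"
    and nle: "\<And>c d. c \<in> dom P \<Longrightarrow> d \<in> dom Q \<Longrightarrow> \<not> (fst d \<le> fst c \<and> snd d \<le> snd c)"
    and le: "\<And>p q. p \<in> ran P \<Longrightarrow> q \<in> ran Q \<Longrightarrow> q \<le> p"
    and strip: "\<And>e. e \<in> ran P \<inter> ran Q \<Longrightarrow> \<exists>S. stable P S \<and> (\<forall>c. P c = Some e \<longrightarrow> c \<in> S) \<and>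
       (\<forall>c d. c \<in> S \<longrightarrow> Q d = Some e \<longrightarrow> snd c < snd d)"
    using inv unfolding loop_inv_def by blast+
  obtain c where uni: "the_unique (rightmost P e) = Some c" and c: "P c = Some e"
    and min: "\<forall>v \<in> ran P. e \<le> v"
    and cells: "\<And>d. P d = Some e \<Longrightarrow> d = c \<or> snd d < snd c \<and> fst c \<le> fst d"
    using rightmost_min[OF reg ord ne e] by blast
  obtain n where "dom P \<subseteq> {..n} \<times> {..n}" using finite_cells_bounded[OF region_finite[OF reg]] by blast
  then obtain P' c' where path: "phi_path P c P' c'" using phi_path_exists[of P n c] c by blast
  have punc: "punctured P c"
    using reg ord c unfolding punctured_def ordered_off_def by blast
  have punc': "punctured P' c'" and dom': "dom P' = dom P" and e': "P' c' = Some e"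
    and corner: "P' (fst c', snd c' + 1) = None" "P' (fst c' + 1, snd c') = None"
    using phi_path_punctured[OF path punc] c by auto
  have c': "c' \<in> dom P" using e' dom' by auto
  have ran': "ran P' \<subseteq> ran P" by (rule phi_path_ran[OF path])
  let ?R = "P'(c' := None)" and ?Q = "Q(c' := Some e)"
  have domR: "dom ?R = dom P - {c'}" using dom' by auto
  \<comment> \<open>The slide stops where there is no right and no lower neighbour, hence at a
    maximal cell.\<close>
  have max: "d = c'" if "d \<in> dom P" "fst c' \<le> fst d" "snd c' \<le> snd d" for d
    using region_maximal[of "dom P" "fst c'" "snd c'" "fst d" "snd d"] reg corner c' that dom'
    by (auto simp: domIff)
  have Qc': "Q c' = None" using nle[OF c', of c'] by auto
  have eP: "e \<in> ran P" using c by (rule ranI)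
  have ranR: "ran ?R \<subseteq> ran P" using ran' by (fastforce simp: ran_def split: if_splits)
  have ranQ: "ran ?Q = insert e (ran Q)" using Qc' by auto
  \<comment> \<open>If \<open>e\<close> was recorded before, \<open>strip\<close> supplies a trap
    that contains all remaining copies of \<open>e\<close>, so the present path ends inside
    it.\<close>
  have left: "snd c' < snd d" if d: "Q d = Some e" for d
  proof -
    obtain S where S: "stable P S" "\<And>c. P c = Some e \<Longrightarrow> c \<in> S" "\<And>c. c \<in> S \<Longrightarrow> snd c < snd d"
      using strip[of e] eP ranI[of Q d e] d by blast
    have "c' \<in> S" by (rule stable_phi_path[OF path S(1)]) (use S(2) c in auto)
    then show ?thesis by (rule S(3))
  qed
  have "loop_inv ?R ?Q"
    unfolding loop_inv_def
  proof (intro conjI)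
    show "region (dom ?R)"
      unfolding domR using region_remove_maximal[OF reg, of "fst c'" "snd c'"] max by fastforce
    have "ordered_off {c'} P'" using punc' unfolding punctured_def by blast
    then show "ordered_off {} ?R" by (rule ordered_off_remove)
    show "finite (dom ?Q)" using fQ by simp
    show "reverse_semistandard ?Q"
      unfolding reverse_semistandard_def
    proof (intro conjI allI impI)
      fix i j j' a b
      assume *: "j < j'" "?Q (i, j) = Some a" "?Q (i, j') = Some b"
      show "b \<le> a"
      \<comment> \<open>A cell of \<open>Q\<close> to the left of \<open>c'\<close> in the same row
        is impossible, as no cell of \<open>Q\<close> lies northwest of a cell of
        \<open>P\<close>.\<close>
      proof (cases "c' = (i, j')")
        case True
        then show ?thesis using nle[OF c', of "(i, j)"] * by auto
      next
        case False
        then show ?thesis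
          using * rev le[OF eP, of b] ranI[of Q "(i, j')" b]
          unfolding reverse_semistandard_def by (auto split: if_splits)
      qed
    next
      fix i i' j a b
      assume *: "i < i'" "?Q (i, j) = Some a" "?Q (i', j) = Some b"
      show "b < a"
      proof (cases "c' = (i', j)")
        case True
        then show ?thesis using nle[OF c', of "(i, j)"] * by auto
      next
        case False
        then have b: "Q (i', j) = Some b" using * by auto
        show ?thesis
        proof (cases "c' = (i, j)")
          case True
          \<comment> \<open>Equality in a column is the only danger, and \<open>left\<close> keeps
            earlier copies of \<open>e\<close> out of the column of \<open>c'\<close>.\<close>
          then have "b \<noteq> e" using left[of "(i', j)"] b by auto
          then show ?thesis using le[OF eP ranI[of Q, OF b]] * True by auto
        next
          case False
          then show ?thesis using * b rev unfolding reverse_semistandard_def by auto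
        qed
      qed
    qed
    show "\<forall>c d. c \<in> dom ?R \<longrightarrow> d \<in> dom ?Q \<longrightarrow> \<not> (fst d \<le> fst c \<and> snd d \<le> snd c)"
    proof (intro allI impI)
      fix c d assume "c \<in> dom ?R" "d \<in> dom ?Q"
      then have "c \<in> dom P" "c \<noteq> c'" "d = c' \<or> d \<in> dom Q" unfolding domR by auto
      then show "\<not> (fst d \<le> fst c \<and> snd d \<le> snd c)" using nle[of c d] max[of c] by blast
    qed
    show "\<forall>p \<in> ran ?R. \<forall>q \<in> ran ?Q. q \<le> p"
    proof (intro ballI)
      fix p q assume "p \<in> ran ?R" "q \<in> ran ?Q"
      then have "p \<in> ran P" "q = e \<or> q \<in> ran Q" using ranR ranQ by blast+
      then show "q \<le> p" using min le by blast
    qed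
    show "\<forall>f \<in> ran ?R \<inter> ran ?Q. \<exists>S. stable ?R S \<and> (\<forall>c. ?R c = Some f \<longrightarrow> c \<in> S) \<and>
      (\<forall>c d. c \<in> S \<longrightarrow> ?Q d = Some f \<longrightarrow> snd c < snd d)"
    proof
      fix f assume f: "f \<in> ran ?R \<inter> ran ?Q"
      then have "e \<le> f" using ranR min by auto
      moreover have "f \<le> e" using f le[OF eP] unfolding ranQ by auto
      ultimately have [simp]: "f = e" by simp
      \<comment> \<open>The trap for the next round consists of the cells to the left of the path
        just taken.\<close>
      obtain S where S: "{(p, q). fst c \<le> p \<and> q < snd c} \<subseteq> S" "\<forall>d \<in> S. snd d < snd c'" "stable ?R S"
        using phi_path_barrier[OF path punc] by blast
      have "d \<in> S" if "?R d = Some e" for d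
      proof -
        have "d \<noteq> c'" "P' d = Some e" using that by (auto split: if_splits)
        then have "snd d < snd c \<and> fst c \<le> fst d"
          using phi_path_min_cells[OF path c le_refl cells, of d] by auto
        then show ?thesis using S(1) by (cases d) auto
      qed
      moreover have "snd z < snd d" if "z \<in> S" "?Q d = Some e" for z d
        using S(2) that left[of d] by (fastforce split: if_splits)
      ultimately show "\<exists>S. stable ?R S \<and> (\<forall>c. ?R c = Some f \<longrightarrow> c \<in> S) \<and>
        (\<forall>c d. c \<in> S \<longrightarrow> ?Q d = Some f \<longrightarrow> snd c < snd d)"
        using S(3) by (intro exI[of _ S]) (simp del: fun_upd_apply)
    qed
  qed
  \<comment> \<open>Entries of \<open>Q\<close> never exceed those of \<open>P\<close>, so the entry
    just recorded is the one that \<open>Psi\<close> selects first.\<close>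
  moreover have "Max (ran ?Q) = e"
    unfolding ranQ using finite_ran[OF fQ] le[OF eP] by (intro Max_eqI) auto
  moreover have "the_unique (leftmost ?Q e) = Some c'"
  proof (rule the_unique_eq)
    have "snd c' \<le> snd d" if "?Q d = Some e" for d
      using left[of d] that by (cases "d = c'") auto
    then show "leftmost ?Q e c'" unfolding leftmost_def by simp
    fix d assume "leftmost ?Q e d"
    then have "?Q d = Some e" "snd d \<le> snd c'" unfolding leftmost_def by (blast, metis fun_upd_same)
    then show "d = c'" using left[of d] by (cases "d = c'") auto
  qed
  \<comment> \<open>Retracing leads back to \<open>P\<close> at \<open>c\<close>; from there the
    slide may run on through equal minimal entries, hence the unspecified end cell
    \<open>c0\<close>.\<close>
  moreover obtain c0 where "slide psi_next P' c' = Some (P, c0)"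
    using psi_slide_min[OF reg ord, of "fst c" "snd c" e] c min phi_path_retrace[OF path punc]
    by (metis prod.collapse)
  ultimately show ?thesis
    by (intro that[OF uni phi_path_slide[OF path] _ e' dom' c' Qc' phi_path_norm[OF path punc] ran'])
qed

text \<open>Induction on the number of cells left in \<open>P\<close>. The last conjunct is the left
  inverse in a form that survives the induction: \<open>Psi\<close>, started on the final
  \<open>Q'\<close>, passes through the intermediate state \<open>(Q, P)\<close>.\<close>

lemma phi_loop_correct:
  assumes "loop_inv P Q"
  shows "\<exists>Q'. phi_loop P Q = Some Q' \<and> reverse_semistandard Q' \<and> dom Q' = dom P \<union> dom Q
    \<and> ran Q' \<subseteq> ran P \<union> ran Q \<and> norm_of Q' = norm_of P + norm_of Q
    \<and> psi_loop Q' Map.empty = psi_loop Q P"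
  using assms
proof (induction "card (dom P)" arbitrary: P Q rule: less_induct)
  case less
  show ?case
  proof (cases "P = Map.empty")
    case True
    then show ?thesis using less.prems
      by (subst phi_loop.simps) (simp add: loop_inv_def norm_of_def)
  next
    case False
    define e where "e = Min (ran P)"
    obtain c P' c' c0 where s: "the_unique (rightmost P e) = Some c"
      "slide phi_next P c = Some (P', c')" "loop_inv (P'(c' := None)) (Q(c' := Some e))"
      "P' c' = Some e" "dom P' = dom P" "c' \<in> dom P" "Q c' = None" "norm_of P' = norm_of P"
      "ran P' \<subseteq> ran P" "Max (ran (Q(c' := Some e))) = e"
      "the_unique (leftmost (Q(c' := Some e)) e) = Some c'" "slide psi_next P' c' = Some (P, c0)"
      using phi_step[OF less.prems False e_def] by blast
    let ?R = "P'(c' := None)" and ?Q = "Q(c' := Some e)"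
    have fin: "finite (dom P)" "finite (dom Q)"
      using less.prems region_finite unfolding loop_inv_def by auto
    have domR: "dom ?R = dom P - {c'}" using s(5) by auto
    then have "card (dom ?R) < card (dom P)" using s(6) fin(1) by (metis card_Diff1_less)
    then obtain Q' where Q': "phi_loop ?R ?Q = Some Q'" "reverse_semistandard Q'"
      "dom Q' = dom ?R \<union> dom ?Q" "ran Q' \<subseteq> ran ?R \<union> ran ?Q" "norm_of Q' = norm_of ?R + norm_of ?Q"
      "psi_loop Q' Map.empty = psi_loop ?Q ?R"
      using less.hyps s(3) by blast
    \<comment> \<open>Reinserting \<open>e\<close> at \<open>c'\<close> recovers the tableau at the
      end of the forward slide, where the backward slide begins.\<close>
    have R: "?R(c' := Some e) = P'" and Q: "?Q(c' := None) = Q" "Q(c' := None) = Q"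
      using s(4,7) by (auto simp: fun_eq_iff)
    have "phi_loop P Q = Some Q'"
      using False Q'(1) s(1,2)
      by (subst phi_loop.simps) (simp add: e_def[symmetric] del: fun_upd_apply)
    moreover have "dom Q' = dom P \<union> dom Q" unfolding Q'(3) domR using s(6) by auto
    moreover have "ran ?R \<subseteq> ran P" using s(9) by (fastforce simp: ran_def split: if_splits)
    then have "ran Q' \<subseteq> ran P \<union> ran Q" using Q'(4) s(4,7,9) ranI[of P' c' e] by auto
    moreover have "norm_of Q' = norm_of P + norm_of Q"
      using Q'(5) norm_of_upd[OF fin(2), of c' e] norm_of_upd[of P' c' e] fin(1) s(5,8) R Q
      by (simp del: fun_upd_apply)
    moreover have "psi_loop ?Q ?R = psi_loop Q P"
    proof -
      have "?Q \<noteq> Map.empty" by (metis fun_upd_same option.distinct(1))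
      then show ?thesis
        using s(10,11,12) R Q by (subst psi_loop.simps) (simp del: fun_upd_apply)
    qed
    ultimately show ?thesis using Q'(2,6) by auto
  qed
qed

section \<open>Skew shapes and their tableaux\<close>

lemma nth_antimono:
  assumes "is_partition l" "i \<le> k" "k < length l"
  shows "l ! k \<le> l ! i"
  using assms sorted_wrt_nth_less[of "(\<ge>)" l i k] unfolding is_partition_def
  by (cases "i = k") auto

lemma diagram_down_closed:
  assumes "is_partition l" "(i, j) \<in> diagram l" "1 \<le> p" "p \<le> i" "1 \<le> q" "q \<le> j"
  shows "(p, q) \<in> diagram l"
  using assms nth_antimono[OF assms(1), of "p - 1" "i - 1"] unfolding diagram_def by fastforce

lemma finite_diagram: "finite (diagram l)"
proof (rule finite_subset)
  show "diagram l \<subseteq> {..length l} \<times> {..Max (set l)}"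
    by (force simp: diagram_def intro!: order.trans[OF _ Max_ge])
qed simp

text \<open>An intermediate cell lies in \<open>diagram l\<close> because of the southeast cell; it
  avoids \<open>diagram m\<close> since otherwise the northwest cell would lie there too.\<close>

lemma region_skew:
  assumes "is_partition l" "is_partition m"
  shows "region (skew l m)"
  unfolding region_def
proof (intro conjI allI impI)
  show "finite (skew l m)" unfolding skew_def using finite_diagram by blast
  show "\<forall>(i, j) \<in> skew l m. 0 < i \<and> 0 < j" unfolding skew_def diagram_def by auto
next
  fix i j i' j' p q
  assume *: "(i, j) \<in> skew l m" "(i', j') \<in> skew l m" "i \<le> p" "p \<le> i'" "j \<le> q" "q \<le> j'"
  then have "1 \<le> i" "1 \<le> j" unfolding skew_def diagram_def by auto
  then show "(p, q) \<in> skew l m"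
    using * diagram_down_closed[OF assms(1), of i' j' p q] diagram_down_closed[OF assms(2), of p q i j]
    unfolding skew_def by auto
qed

text \<open>Two cells are compared along row \<open>i\<close> and then down column
  \<open>j'\<close>; convexity guarantees an entry at the bend \<open>(i, j')\<close>.\<close>

lemma SSYT_ordered:
  assumes "is_partition l" "is_partition m" "P \<in> SSYT l m"
  shows "ordered_off {} P"
  unfolding ordered_off_def
proof (intro allI impI)
  fix i j i' j' a b
  assume le: "i \<le> i'" "j \<le> j'" and a: "P (i, j) = Some a" and b: "P (i', j') = Some b"
  have row: "x \<le> y" if "q \<le> q'" "P (p, q) = Some x" "P (p, q') = Some y" for p q q' x y
  proof (cases "q = q'")
    case False
    then show ?thesis using assms(3) that unfolding SSYT_def by (blast intro: le_neq_trans)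
  qed (use that in simp)
  have col: "x < y" if "p < p'" "P (p, q) = Some x" "P (p', q) = Some y" for p p' q x y
    using assms(3) that unfolding SSYT_def by blast
  have "region (dom P)"
    using assms(3) region_skew[OF assms(1,2)] unfolding SSYT_def tabloids_def by simp
  then have "(i, j') \<in> dom P" using region_convex[of "dom P" i j i' j' i j'] a b le by blast
  then obtain v where v: "P (i, j') = Some v" by blast
  then show "a \<le> b \<and> (i < i' \<longrightarrow> a < b)"
    using row[OF le(2) a v] col[OF _ v b] b le by (cases "i = i'") auto
qed

text \<open>The range inclusion keeps bounds on the entries, as the counting argument
  requires.\<close>

lemma Phi_correct:
  assumes "is_partition l" "is_partition m" "P \<in> SSYT l m"
  obtains Q where "Phi P = Some Q" "Q \<in> reverse_SSYT l m" "ran Q \<subseteq> ran P" "norm_of Q = norm_of P"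
    "Psi Q = Some P"
proof -
  have dom: "dom P = skew l m" using assms(3) unfolding SSYT_def tabloids_def by auto
  have "loop_inv P Map.empty"
    using SSYT_ordered[OF assms] region_skew[OF assms(1,2)]
    unfolding loop_inv_def dom reverse_semistandard_def by auto
  then obtain Q where Q: "phi_loop P Map.empty = Some Q" "reverse_semistandard Q" "dom Q = dom P"
    "ran Q \<subseteq> ran P" "norm_of Q = norm_of P" "psi_loop Q Map.empty = psi_loop Map.empty P"
    using phi_loop_correct[of P Map.empty] by (auto simp: norm_of_def)
  show ?thesis
  proof (rule that)
    show "Q \<in> reverse_SSYT l m"
      using Q(2) unfolding reverse_SSYT_def reverse_semistandard_def tabloids_def
      by (simp only: mem_Collect_eq Q(3) dom simp_thms)
    show "Psi Q = Some P" unfolding Psi_def Q(6) by (subst psi_loop.simps) (simp only: refl if_True)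
  qed (use Q in \<open>auto simp: Phi_def\<close>)
qed

section \<open>Surjectivity by counting\<close>

text \<open>An order-reversing involution on fillings with entries at most \<open>N\<close>; beyond
  \<open>N\<close> the truncated subtraction would collapse entries.\<close>

definition complement :: "nat \<Rightarrow> filling \<Rightarrow> filling" where
  "complement N T = (\<lambda>c. map_option (\<lambda>x. N - x) (T c))"

lemma dom_complement: "dom (complement N T) = dom T"
  unfolding complement_def dom_def by auto

lemma ran_complement: "ran (complement N T) \<subseteq> {..N}"
  unfolding complement_def ran_def by auto

lemma complement_complement: "ran T \<subseteq> {..N} \<Longrightarrow> complement N (complement N T) = T"
  unfolding complement_def
proof
  fix c assume r: "ran T \<subseteq> {..N}"
  show "map_option ((-) N) (map_option ((-) N) (T c)) = T c"
    using r ranI[of T c] by (cases "T c") auto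
qed

lemma complement_SSYT:
  assumes "T \<in> SSYT l m" "ran T \<subseteq> {..N}"
  shows "complement N T \<in> reverse_SSYT l m"
  unfolding reverse_SSYT_def tabloids_def mem_Collect_eq dom_complement
proof (intro conjI allI impI)
  show "dom T = skew l m" using assms(1) unfolding SSYT_def tabloids_def by blast
next
  fix i j j' a b
  assume "j < j'" "complement N T (i, j) = Some a" "complement N T (i, j') = Some b"
  moreover from this obtain x y where "T (i, j) = Some x" "a = N - x" "T (i, j') = Some y" "b = N - y"
    unfolding complement_def by auto
  ultimately show "b \<le> a" using assms(1) unfolding SSYT_def by (blast intro: diff_le_mono2)
next
  fix i i' j a b
  assume i: "i < i'" and "complement N T (i, j) = Some a" "complement N T (i', j) = Some b"
  then obtain x y where xy: "T (i, j) = Some x" "a = N - x" "T (i', j) = Some y" "b = N - y"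
    unfolding complement_def by auto
  then have "y \<le> N" "x < y" using assms i ranI[of T, OF xy(3)] unfolding SSYT_def by blast+
  then show "b < a" using xy by simp
qed

lemma complement_reverse_SSYT:
  assumes "T \<in> reverse_SSYT l m" "ran T \<subseteq> {..N}"
  shows "complement N T \<in> SSYT l m"
  unfolding SSYT_def tabloids_def mem_Collect_eq dom_complement
proof (intro conjI allI impI)
  show "dom T = skew l m" using assms(1) unfolding reverse_SSYT_def tabloids_def by blast
next
  fix i j j' a b
  assume "j < j'" "complement N T (i, j) = Some a" "complement N T (i, j') = Some b"
  moreover from this obtain x y where "T (i, j) = Some x" "a = N - x" "T (i, j') = Some y" "b = N - y"
    unfolding complement_def by auto
  ultimately show "a \<le> b" using assms(1) unfolding reverse_SSYT_def by (blast intro: diff_le_mono2)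
next
  fix i i' j a b
  assume i: "i < i'" and "complement N T (i, j) = Some a" "complement N T (i', j) = Some b"
  then obtain x y where xy: "T (i, j) = Some x" "a = N - x" "T (i', j) = Some y" "b = N - y"
    unfolding complement_def by auto
  then have "x \<le> N" "y < x" using assms i ranI[of T, OF xy(1)] unfolding reverse_SSYT_def by blast+
  then show "a < b" using xy by simp
qed

text \<open>\<open>Phi\<close> maps the bounded set \<open>A\<close> into \<open>B\<close> and is
  injective there because \<open>Psi\<close> undoes it; both sets are finite of equal size, so every
  element of \<open>B\<close> is attained.\<close>

lemma Phi_surj:
  assumes "is_partition l" "is_partition m" "Q \<in> reverse_SSYT l m"
  obtains P where "P \<in> SSYT l m" "Phi P = Some Q"
proof -
  define D where "D = skew l m"
  have fD: "finite D" unfolding D_def by (rule region_finite[OF region_skew[OF assms(1,2)]])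
  have "dom Q = D" using assms(3) unfolding reverse_SSYT_def tabloids_def D_def by auto
  then have "finite (ran Q)" using fD by (simp add: finite_ran)
  \<comment> \<open>For empty \<open>ran Q\<close> the maximum is unspecified, but the inclusion is
    trivial.\<close>
  then have "ran Q \<subseteq> {..Max (ran Q)}" by auto
  then obtain N where N: "ran Q \<subseteq> {..N}" by blast
  define A B where "A = {T \<in> SSYT l m. ran T \<subseteq> {..N}}" and "B = {T \<in> reverse_SSYT l m. ran T \<subseteq> {..N}}"
  have "finite {T. dom T = D \<and> ran T \<subseteq> {..N}}" using fD by (simp add: finite_set_of_finite_maps)
  then have fin: "finite B"
    by (rule finite_subset[rotated]) (auto simp: B_def reverse_SSYT_def tabloids_def D_def)
  have "bij_betw (complement N) A B"
    using ran_complement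
    by (intro bij_betw_byWitness[where f' = "complement N"])
      (auto simp only: A_def B_def mem_Collect_eq complement_complement complement_SSYT
        complement_reverse_SSYT)
  then have card: "card A = card B" by (rule bij_betw_same_card)
  let ?F = "\<lambda>P. the (Phi P)"
  have F: "Phi P = Some (?F P)" "?F P \<in> B" "Psi (?F P) = Some P" if "P \<in> A" for P
  proof -
    have P: "P \<in> SSYT l m" "ran P \<subseteq> {..N}" using that unfolding A_def by auto
    then obtain Q where "Phi P = Some Q" "Q \<in> reverse_SSYT l m" "ran Q \<subseteq> ran P" "Psi Q = Some P"
      using Phi_correct[OF assms(1,2) P(1)] by blast
    then show "Phi P = Some (?F P)" "?F P \<in> B" "Psi (?F P) = Some P"
      using P(2) unfolding B_def by simp_all
  qed
  have "inj_on ?F A" 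
  proof (rule inj_onI)
    fix P P' assume P: "P \<in> A" "P' \<in> A" "?F P = ?F P'"
    show "P = P'" using F(3)[OF P(1)] F(3)[OF P(2)] unfolding P(3) by simp
  qed
  then have "card (?F ` A) = card B" using card by (simp add: card_image)
  moreover have "?F ` A \<subseteq> B" using F(2) by (rule image_subsetI)
  ultimately have "?F ` A = B" using fin by (intro card_subset_eq)
  moreover have "Q \<in> B" using assms(3) N unfolding B_def by simp
  ultimately have "Q \<in> ?F ` A" by simp
  then obtain P where P: "Q = ?F P" "P \<in> A" by (rule imageE)
  show ?thesis
  proof (rule that)
    show "P \<in> SSYT l m" using P(2) unfolding A_def by simp
    show "Phi P = Some Q" unfolding P(1) by (rule F(1)[OF P(2)])
  qed
qed

section \<open>The two inverse bijections\<close>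

theorem theorem2p1:
  fixes l m :: "nat list"
  assumes "is_partition l" and "is_partition m" and "contained_in m l"
  shows "(\<forall>P \<in> SSYT l m. \<exists>Q \<in> reverse_SSYT l m. Phi P = Some Q)
    \<and> (\<forall>Q \<in> reverse_SSYT l m. \<exists>P \<in> SSYT l m. Psi Q = Some P)
    \<and> (\<forall>P \<in> SSYT l m. \<forall>Q. Phi P = Some Q \<longrightarrow> norm_of Q = norm_of P)
    \<and> (\<forall>Q \<in> reverse_SSYT l m. \<forall>P. Psi Q = Some P \<longrightarrow> norm_of P = norm_of Q)
    \<and> (\<forall>P \<in> SSYT l m. \<forall>Q. Phi P = Some Q \<longrightarrow> Psi Q = Some P)
    \<and> (\<forall>Q \<in> reverse_SSYT l m. \<forall>P. Psi Q = Some P \<longrightarrow> Phi P = Some Q)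
    \<and> bij_betw (\<lambda>P. the (Phi P)) (SSYT l m) (reverse_SSYT l m)
    \<and> bij_betw (\<lambda>Q. the (Psi Q)) (reverse_SSYT l m) (SSYT l m)"
proof -
  have Phi: "\<exists>Q \<in> reverse_SSYT l m. Phi P = Some Q \<and> norm_of Q = norm_of P \<and> Psi Q = Some P"
    if "P \<in> SSYT l m" for P
    using Phi_correct[OF assms(1,2) that] by blast
  \<comment> \<open>Every \<open>Q\<close> is the image of some \<open>P\<close> under
    \<open>Phi\<close>, so termination and correctness of \<open>Psi\<close> on \<open>Q\<close> are
    inherited from the left inverse property.\<close>
  have Psi: "\<exists>P \<in> SSYT l m. Psi Q = Some P \<and> norm_of P = norm_of Q \<and> Phi P = Some Q"
    if Q: "Q \<in> reverse_SSYT l m" for Q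
  proof -
    obtain P where P: "P \<in> SSYT l m" "Phi P = Some Q" using Phi_surj[OF assms(1,2) Q] by blast
    then show ?thesis using Phi[OF P(1)] by auto
  qed
  have PhiD: "the (Phi P) \<in> reverse_SSYT l m" "the (Psi (the (Phi P))) = P" if "P \<in> SSYT l m" for P
    using Phi[OF that] by auto
  have PsiD: "the (Psi Q) \<in> SSYT l m" "the (Phi (the (Psi Q))) = Q" if "Q \<in> reverse_SSYT l m" for Q
    using Psi[OF that] by auto
  show ?thesis
  proof (intro conjI ballI allI impI)
    show "bij_betw (\<lambda>P. the (Phi P)) (SSYT l m) (reverse_SSYT l m)"
      by (rule bij_betw_byWitness[where f' = "\<lambda>Q. the (Psi Q)"]) (use PhiD PsiD in auto)
    show "bij_betw (\<lambda>Q. the (Psi Q)) (reverse_SSYT l m) (SSYT l m)"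
      by (rule bij_betw_byWitness[where f' = "\<lambda>P. the (Phi P)"]) (use PhiD PsiD in auto)
  next
    fix P assume P: "P \<in> SSYT l m"
    show "\<exists>Q \<in> reverse_SSYT l m. Phi P = Some Q" using Phi[OF P] by blast
    fix Q assume "Phi P = Some Q"
    then show "norm_of Q = norm_of P" "Psi Q = Some P" using Phi[OF P] by auto
  next
    fix Q assume Q: "Q \<in> reverse_SSYT l m"
    show "\<exists>P \<in> SSYT l m. Psi Q = Some P" using Psi[OF Q] by blast
    fix P assume "Psi Q = Some P"
    then show "norm_of P = norm_of Q" "Phi P = Some Q" using Psi[OF Q] by auto
  qed
qed

end
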